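(* Let $F$ be a field of characteristic zero, let $k \geq 1$, let $n_1 \geq n_2 \geq \dots \geq n_k \geq 1$ be integers, and let $L_{k+1}(N)$ be the solvable Lie algebra over $F$ defined in the context, with model nilradical $N$ of characteristic sequence $(n_1,\dots,n_k,1)$ and complementary space of dimension $k+1$. Then every local derivation on $L_{k+1}(N)$ is a derivation.
   Context: Put $n = n_1 + \dots + n_k + 1$. The model nilpotent Lie algebra $N$ with characteristic sequence $(n_1,\dots,n_k,1)$ has basis $\{e_1,\dots,e_n\}$ and products $[e_i,e_1] = e_{i+1}$ for $2 \leq i \leq n_1$, and $[e_{n_1+\dots+n_{j-1}+i}, e_1] = e_{n_1+\dots+n_{j-1}+i+1}$ for $2 \leq j \leq k$, $2 \leq i \leq n_j$. The algebra $L_{k+1}(N)$ has basis $\{x_1,\dots,x_{k+1},e_1,\dots,e_n\}$ and multiplication $$[e_i,e_1] = e_{i+1}, \quad 2 \leq i \leq n_1,$$ $$[e_{n_1+\dots+n_{j-1}+i}, e_1] = e_{n_1+\dots+n_{j-1}+i+1}, \quad 2 \leq j \leq k,\ 2 \leq i \leq n_j,$$ $$[e_i,x_1] = i e_i, \quad 1 \leq i \leq n,$$ $$[e_i,x_2] = e_i, \quad 2 \leq i \leq n_1+1,$$ $$[e_{n_1+\dots+n_{j-2}+i}, x_j] = e_{n_1+\dots+n_{j-2}+i}, \quad 3 \leq j \leq k+1,\ 2 \leq i \leq n_{j-1}+1,$$ where products are extended by skew-symmetry and all remaining products of basis elements are zero. A derivation of a Lie algebra $L$ is a linear map $d : L \to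 L$ with $d([u,v]) = [d(u),v] + [u,d(v)]$ for all $u,v \in L$. A linear map $\Delta : L \to L$ is called a local derivation if for every $u \in L$ there exists a derivation $d_u : L \to L$ (depending on $u$) such that $\Delta(u) = d_u(u)$. *)

theory Defs
  imports Complex_Main "HOL-Library.Function_Algebras"
begin

section \<open>Lie algebras, derivations and local derivations\<close>

text \<open>
  The dimension of the algebras below varies with the parameters, so a Lie algebra is a
  subspace \<open>L\<close> of an ambient vector space with a bracket; maps are constrained on \<open>L\<close> only.
\<close>

locale lie_algebra = vector_space scale
  for scale :: "'f::field \<Rightarrow> 'v::ab_group_add \<Rightarrow> 'v" +
  fixes L :: "'v set" and br :: "'v \<Rightarrow> 'v \<Rightarrow> 'v"
  assumes subspace_L: "subspace L"
    and br_closed: "u \<in> L \<Longrightarrow> v \<in> L \<Longrightarrow> br u v \<in> L"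
    and br_add_left: "u \<in> L \<Longrightarrow> v \<in> L \<Longrightarrow> w \<in> L \<Longrightarrow> br (u + v) w = br u w + br v w"
    and br_add_right: "u \<in> L \<Longrightarrow> v \<in> L \<Longrightarrow> w \<in> L \<Longrightarrow> br u (v + w) = br u v + br u w"
    and br_scale_left: "u \<in> L \<Longrightarrow> v \<in> L \<Longrightarrow> br (scale a u) v = scale a (br u v)"
    and br_scale_right: "u \<in> L \<Longrightarrow> v \<in> L \<Longrightarrow> br u (scale a v) = scale a (br u v)"
    and br_self: "u \<in> L \<Longrightarrow> br u u = 0"
    and jacobi: "u \<in> L \<Longrightarrow> v \<in> L \<Longrightarrow> w \<in> L \<Longrightarrow>
      br u (br v w) + br v (br w u) + br w (br u v) = 0"

definition linear_endo :: "('f::field \<Rightarrow> 'v::ab_group_add \<Rightarrow> 'v) \<Rightarrow> 'v set \<Rightarrow> ('v \<Rightarrow> 'v) \<Rightarrow> bool"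
  where "linear_endo scale L f \<longleftrightarrow>
    (\<forall>u\<in>L. f u \<in> L) \<and>
    (\<forall>u\<in>L. \<forall>v\<in>L. f (u + v) = f u + f v) \<and>
    (\<forall>a. \<forall>u\<in>L. f (scale a u) = scale a (f u))"

definition derivation ::
    "('f::field \<Rightarrow> 'v::ab_group_add \<Rightarrow> 'v) \<Rightarrow> 'v set \<Rightarrow> ('v \<Rightarrow> 'v \<Rightarrow> 'v) \<Rightarrow> ('v \<Rightarrow> 'v) \<Rightarrow> bool"
  where "derivation scale L br d \<longleftrightarrow>
    linear_endo scale L d \<and>
    (\<forall>u\<in>L. \<forall>v\<in>L. d (br u v) = br (d u) v + br u (d v))"

definition local_derivation ::
    "('f::field \<Rightarrow> 'v::ab_group_add \<Rightarrow> 'v) \<Rightarrow> 'v set \<Rightarrow> ('v \<Rightarrow> 'v \<Rightarrow> 'v) \<Rightarrow> ('v \<Rightarrow> 'v) \<Rightarrow> bool"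
  where "local_derivation scale L br \<Delta> \<longleftrightarrow>
    linear_endo scale L \<Delta> \<and>
    (\<forall>u\<in>L. \<exists>d. derivation scale L br d \<and> \<Delta> u = d u)"


section \<open>The solvable algebra with model nilradical\<close>

datatype generator = X nat | E nat

text \<open>\<open>offset n j = n 1 + \<dots> + n (j - 1)\<close>, for a sequence \<open>n\<close> indexed from 1.\<close>

definition offset :: "(nat \<Rightarrow> nat) \<Rightarrow> nat \<Rightarrow> nat"
  where "offset n j = (\<Sum>l = 1..<j. n l)"

definition nil_dim :: "nat \<Rightarrow> (nat \<Rightarrow> nat) \<Rightarrow> nat"
  where "nil_dim k n = (\<Sum>l = 1..k. n l) + 1"

definition solv_basis :: "nat \<Rightarrow> (nat \<Rightarrow> nat) \<Rightarrow> generator set"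
  where "solv_basis k n = X ` {1..k + 1} \<union> E ` {1..nil_dim k n}"

text \<open>Vectors are coefficient functions \<open>generator \<Rightarrow> 'f\<close> vanishing off the basis.\<close>

definition fscale :: "'f::field \<Rightarrow> (generator \<Rightarrow> 'f) \<Rightarrow> generator \<Rightarrow> 'f"
  where "fscale a v = (\<lambda>g. a * v g)"

definition bvec :: "generator \<Rightarrow> generator \<Rightarrow> 'f::field"
  where "bvec b = (\<lambda>g. if g = b then 1 else 0)"

definition solv_space :: "nat \<Rightarrow> (nat \<Rightarrow> nat) \<Rightarrow> (generator \<Rightarrow> 'f::field) set"
  where "solv_space k n = {v. \<forall>g. g \<notin> solv_basis k n \<longrightarrow> v g = 0}"

text \<open>
  The listed products, before extension by skew-symmetry.  In the products with \<open>x\<^sub>l\<close>, \<open>l \<ge> 2\<close>,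
  the generator \<open>x\<^sub>l\<close> acts on the block numbered \<open>l - 1\<close>, so the indices start at
  \<open>offset n (l - 1) = n 1 + \<dots> + n (l - 2)\<close>.
\<close>

fun table :: "nat \<Rightarrow> (nat \<Rightarrow> nat) \<Rightarrow> generator \<Rightarrow> generator \<Rightarrow> generator \<Rightarrow> 'f::field"
  where
    "table k n (E m) (E l) =
      (if l = 1 \<and> (\<exists>j\<in>{1..k}. \<exists>i\<in>{2..n j}. m = offset n j + i) then bvec (E (m + 1)) else 0)"
  | "table k n (E m) (X l) =
      (if l = 1 \<and> m \<in> {1..nil_dim k n} then fscale (of_nat m) (bvec (E m))
       else if l \<in> {2..k + 1} \<and> (\<exists>i\<in>{2..n (l - 1) + 1}. m = offset n (l - 1) + i) then bvec (E m)
       else 0)"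
  | "table k n (X l) g = 0"

text \<open>
  At most one of \<open>table k n b c\<close> and \<open>table k n c b\<close> is nonzero, so the difference is the
  skew-symmetric extension; \<open>solv_bracket\<close> is its bilinear extension.
\<close>

definition solv_bracket ::
    "nat \<Rightarrow> (nat \<Rightarrow> nat) \<Rightarrow> (generator \<Rightarrow> 'f::field) \<Rightarrow> (generator \<Rightarrow> 'f) \<Rightarrow> generator \<Rightarrow> 'f"
  where "solv_bracket k n u v =
    (\<Sum>b\<in>solv_basis k n. \<Sum>c\<in>solv_basis k n.
      fscale (u b * v c) (table k n b c - table k n c b))"


section \<open>The bracket satisfies the Lie algebra axioms\<close>

lemma table_skew: "table k n b c = 0 \<or> table k n c b = (0 :: generator \<Rightarrow> 'f::field)"
  by (cases b; cases c) (auto simp: offset_def)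

lemma finite_solv_basis [simp]: "finite (solv_basis k n)"
  by (simp add: solv_basis_def)

lemma sum_fun_apply: "(\<Sum>b\<in>A. f b) g = (\<Sum>b\<in>A. f b g :: 'f::field)"
  by (induction A rule: infinite_finite_induct) auto

lemma solv_bracket_bvec:
  assumes "b \<in> solv_basis k n" "c \<in> solv_basis k n"
  shows "solv_bracket k n (bvec b) (bvec c) =
    (table k n b c - table k n c b :: generator \<Rightarrow> 'f::field)"
proof
  fix g
  have "solv_bracket k n (bvec b) (bvec c) g =
    (\<Sum>b'\<in>solv_basis k n. \<Sum>c'\<in>solv_basis k n.
       if c' = c then (if b' = b then (table k n b' c' - table k n c' b') g else 0)
       else (0::'f))"
    unfolding solv_bracket_def sum_fun_apply
    by (intro sum.cong refl) (auto simp: fscale_def bvec_def)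
  also have "\<dots> = (table k n b c - table k n c b) g"
    using assms by (simp add: sum.delta)
  finally show "solv_bracket k n (bvec b) (bvec c) g =
    (table k n b c - table k n c b :: generator \<Rightarrow> 'f) g" .
qed

interpretation fvs: vector_space "fscale :: 'f::field \<Rightarrow> _"
  by unfold_locales (auto simp: fscale_def fun_eq_iff algebra_simps)

text \<open>
  The remaining definitions serve only the proof: \<open>wt k n l m\<close> is the eigenvalue of \<open>x\<^sub>l\<close> on \<open>e\<^sub>m\<close>,
  and \<open>chain k n m\<close> says that \<open>[e\<^sub>m, e\<^sub>1] = e\<^bsub>m+1\<^esub>\<close>.  They give the coordinates of the bracket in
  closed form (\<open>solv_bracket_E\<close>), where the Jacobi identity follows by ring arithmetic.
\<close>

definition chain :: "nat \<Rightarrow> (nat \<Rightarrow> nat) \<Rightarrow> nat \<Rightarrow> bool"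
  where "chain k n m \<longleftrightarrow> (\<exists>j\<in>{1..k}. \<exists>i\<in>{2..n j}. m = offset n j + i)"

definition wt :: "nat \<Rightarrow> (nat \<Rightarrow> nat) \<Rightarrow> nat \<Rightarrow> nat \<Rightarrow> 'f::field"
  where "wt k n l m =
    (if l = 1 then of_nat m
     else if \<exists>i\<in>{2..n (l - 1) + 1}. m = offset n (l - 1) + i then 1 else 0)"

definition act :: "nat \<Rightarrow> (nat \<Rightarrow> nat) \<Rightarrow> (generator \<Rightarrow> 'f::field) \<Rightarrow> nat \<Rightarrow> 'f"
  where "act k n v m = (\<Sum>l = 1..k + 1. v (X l) * wt k n l m)"

lemma offset_Suc: "1 \<le> j \<Longrightarrow> offset n (Suc j) = offset n j + n j"
  by (simp add: offset_def)

lemma offset_mono: "i \<le> j \<Longrightarrow> offset n i \<le> offset n j"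
  unfolding offset_def by (rule sum_mono2) auto

lemma nil_dim_offset: "nil_dim k n = offset n (Suc k) + 1"
  by (simp add: nil_dim_def offset_def atLeastLessThanSuc_atLeastAtMost)

lemma chain_bounds: "chain k n m \<Longrightarrow> 2 \<le> m \<and> m + 1 \<le> nil_dim k n"
  unfolding chain_def nil_dim_offset
  using offset_Suc offset_mono[of "Suc _" "Suc k" n] by fastforce

lemma in_block_iff:
  "1 \<le> j \<Longrightarrow> (\<exists>i\<in>{2..n j + 1}. m = offset n j + i) \<longleftrightarrow>
     offset n j + 2 \<le> m \<and> m \<le> offset n (Suc j) + 1"
  unfolding offset_Suc
  by (auto intro!: bexI[of _ "m - offset n j"])

lemma wt_chain:
  assumes c: "chain k n m" and l: "1 \<le> l"
  shows "wt k n l (m + 1) = (wt k n l m + wt k n l 1 :: 'f::field)"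
proof (cases "l = 1")
  case True
  then show ?thesis by (simp add: wt_def)
next
  case False
  define b where "b = l - 1"
  have b: "1 \<le> b" using False l by (simp add: b_def)
  obtain j where j: "1 \<le> j" "offset n j + 2 \<le> m" "m \<le> offset n (Suc j)"
    using c by (auto simp: chain_def offset_Suc)
  have "(offset n b + 2 \<le> m + 1 \<and> m + 1 \<le> offset n (Suc b) + 1) \<longleftrightarrow>
        (offset n b + 2 \<le> m \<and> m \<le> offset n (Suc b) + 1)"
  proof (cases b j rule: linorder_cases)
    case less
    then have "offset n (Suc b) \<le> offset n j" by (intro offset_mono) auto
    then show ?thesis using j by auto
  next
    case greater
    then have "offset n (Suc j) \<le> offset n b" by (intro offset_mono) auto
    then show ?thesis using j by auto
  next
    case equal
    then show ?thesis using j by auto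
  qed
  then show ?thesis
    using False in_block_iff[OF b, of n m] in_block_iff[OF b, of n "m + 1"]
      in_block_iff[OF b, of n 1]
    unfolding wt_def b_def by auto
qed

lemma act_chain:
  "chain k n m \<Longrightarrow> act k n v (m + 1) = (act k n v m + act k n v 1 :: 'f::field)"
  unfolding act_def by (simp add: wt_chain[simplified] distrib_left sum.distrib)

definition half :: "nat \<Rightarrow> (nat \<Rightarrow> nat) \<Rightarrow> (generator \<Rightarrow> 'f::field) \<Rightarrow> (generator \<Rightarrow> 'f) \<Rightarrow> generator \<Rightarrow> 'f"
  where "half k n u v g =
    (\<Sum>b\<in>solv_basis k n. \<Sum>c\<in>solv_basis k n. u b * v c * table k n b c g)"

lemma solv_bracket_half: "solv_bracket k n u v g = half k n u v g - (half k n v u g :: 'f::field)"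
proof -
  have "solv_bracket k n u v g =
     half k n u v g - (\<Sum>b\<in>solv_basis k n. \<Sum>c\<in>solv_basis k n. u b * v c * table k n c b g)"
    unfolding solv_bracket_def sum_fun_apply half_def
    by (simp add: fscale_def right_diff_distrib sum_subtractf)
  also have "(\<Sum>b\<in>solv_basis k n. \<Sum>c\<in>solv_basis k n. u b * v c * table k n c b g) = half k n v u g"
    unfolding half_def by (subst sum.swap) (simp add: mult_ac)
  finally show ?thesis .
qed

lemma table_X [simp]: "table k n b c (X l) = (0::'f::field)"
  by (cases b; cases c) (auto simp: bvec_def fscale_def)

lemma half_X [simp]: "half k n u v (X l) = (0::'f::field)"
  by (simp add: half_def)

lemma sum_basis:
  "(\<Sum>b\<in>solv_basis k n. f b :: 'f::field) =
   (\<Sum>l=1..k+1. f (X l)) + (\<Sum>m=1..nil_dim k n. f (E m))"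
  unfolding solv_basis_def
  by (subst sum.union_disjoint) (auto simp: sum.reindex inj_on_def)

lemma half_E:
  assumes u: "u \<in> solv_space k n"
  shows "half k n u v (E m) =
    (u (E m) * act k n v m +
     (if chain k n (m - 1) then u (E (m - 1)) * v (E 1) else 0) :: 'f::field)"
proof -
  let ?N = "nil_dim k n"
  have out: "u (E p) = 0" if "p \<notin> {1..?N}" for p
    using u that by (auto simp: solv_space_def solv_basis_def)
  have one: "1 \<in> {1..?N}" by (simp add: nil_dim_def)
  have A: "(\<Sum>l=1..k+1. u (E p) * v (X l) * table k n (E p) (X l) (E m)) =
      (if p = m then u (E m) * act k n v m else 0)" if "p \<in> {1..?N}" for p
  proof -
    have "(\<Sum>l=1..k+1. u (E p) * v (X l) * table k n (E p) (X l) (E m)) =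
       (\<Sum>l=1..k+1. if p = m then u (E m) * (v (X l) * wt k n l m) else 0)"
      using that by (intro sum.cong refl) (auto simp: bvec_def fscale_def wt_def)
    also have "\<dots> = (if p = m then u (E m) * act k n v m else 0)"
      by (cases "p = m") (simp_all add: act_def sum_distrib_left del: sum.cl_ivl_Suc)
    finally show ?thesis .
  qed
  have B: "(\<Sum>l=1..?N. u (E p) * v (E l) * table k n (E p) (E l) (E m)) =
      (if p = m - 1 then (if chain k n (m - 1) then u (E (m - 1)) * v (E 1) else 0) else 0)" for p
  proof -
    have "(\<Sum>l=1..?N. u (E p) * v (E l) * table k n (E p) (E l) (E m)) =
       (\<Sum>l=1..?N. if l = 1 then (if chain k n p \<and> m = p + 1 then u (E p) * v (E 1) else 0) else 0)"
      by (intro sum.cong refl) (auto simp: bvec_def chain_def)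
    also have "\<dots> = (if chain k n p \<and> m = p + 1 then u (E p) * v (E 1) else 0)"
      using one by simp
    also have "\<dots> = (if p = m - 1 then (if chain k n (m - 1) then u (E (m - 1)) * v (E 1) else 0) else 0)"
      using chain_bounds[of k n p] by auto
    finally show ?thesis .
  qed
  have "half k n u v (E m) =
     (\<Sum>p=1..?N. (\<Sum>l=1..k+1. u (E p) * v (X l) * table k n (E p) (X l) (E m)) +
       (\<Sum>l=1..?N. u (E p) * v (E l) * table k n (E p) (E l) (E m)))"
    unfolding half_def sum_basis by simp
  also have "\<dots> = (\<Sum>p=1..?N. if p = m then u (E m) * act k n v m else 0) +
     (\<Sum>p=1..?N. if p = m - 1 then
        (if chain k n (m - 1) then u (E (m - 1)) * v (E 1) else 0) else 0)"
    unfolding sum.distrib[symmetric] by (intro sum.cong refl) (simp only: A B)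
  also have "\<dots> = u (E m) * act k n v m +
     (if chain k n (m - 1) then u (E (m - 1)) * v (E 1) else 0)"
    using out[of m] chain_bounds[of k n "m - 1"] by auto
  finally show ?thesis .
qed

lemma solv_bracket_X [simp]: "solv_bracket k n u v (X l) = (0::'f::field)"
  by (simp add: solv_bracket_half)

lemma solv_bracket_E:
  assumes "u \<in> solv_space k n" "v \<in> solv_space k n"
  shows "solv_bracket k n u v (E m) =
    (u (E m) * act k n v m - v (E m) * act k n u m +
     (if chain k n (m - 1) then u (E (m - 1)) * v (E 1) - v (E (m - 1)) * u (E 1) else 0)
       :: 'f::field)"
  using assms by (simp add: solv_bracket_half half_E)

lemma solv_bracket_closed:
  assumes "u \<in> solv_space k n" "v \<in> solv_space k n"
  shows "solv_bracket k n u v \<in> (solv_space k n :: (generator \<Rightarrow> 'f::field) set)"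
proof -
  have "solv_bracket k n u v g = 0" if g: "g \<notin> solv_basis k n" for g
  proof (cases g)
    case (E m)
    have z: "u (E m) = 0" "v (E m) = 0" using assms g E by (auto simp: solv_space_def)
    have "\<not> chain k n (m - 1)"
      using chain_bounds[of k n "m - 1"] g E by (auto simp: solv_basis_def)
    then show ?thesis using z E by (simp add: solv_bracket_E assms)
  qed simp
  then show ?thesis by (simp add: solv_space_def)
qed

lemma act_bracket [simp]: "act k n (solv_bracket k n u v) m = (0::'f::field)"
  by (simp add: act_def)

theorem solv_lie_algebra:
  "lie_algebra (fscale :: 'f::field \<Rightarrow> _) (solv_space k n) (solv_bracket k n)"
proof (intro lie_algebra.intro fvs.vector_space_axioms lie_algebra_axioms.intro)
  show "fvs.subspace (solv_space k n :: (generator \<Rightarrow> 'f) set)"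
    by (rule fvs.subspaceI) (auto simp: solv_space_def fscale_def)
next
  fix u v w :: "generator \<Rightarrow> 'f" and a :: 'f
  show "solv_bracket k n (u + v) w = solv_bracket k n u w + solv_bracket k n v w"
    by (rule ext) (simp add: solv_bracket_def sum_fun_apply fscale_def algebra_simps
        sum.distrib sum_subtractf)
  show "solv_bracket k n u (v + w) = solv_bracket k n u v + solv_bracket k n u w"
    by (rule ext) (simp add: solv_bracket_def sum_fun_apply fscale_def algebra_simps
        sum.distrib sum_subtractf)
  show "solv_bracket k n (fscale a u) v = fscale a (solv_bracket k n u v)"
    by (rule ext) (simp add: solv_bracket_def sum_fun_apply fscale_def sum_distrib_left mult_ac)
  show "solv_bracket k n u (fscale a v) = fscale a (solv_bracket k n u v)"
    by (rule ext) (simp add: solv_bracket_def sum_fun_apply fscale_def sum_distrib_left mult_ac)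
  show "solv_bracket k n u u = 0"
    by (rule ext) (simp add: solv_bracket_half)
  assume L: "u \<in> solv_space k n" "v \<in> solv_space k n"
  show "solv_bracket k n u v \<in> solv_space k n"
    by (rule solv_bracket_closed[OF L])
  assume Lw: "w \<in> solv_space k n"
  show "solv_bracket k n u (solv_bracket k n v w) + solv_bracket k n v (solv_bracket k n w u) +
    solv_bracket k n w (solv_bracket k n u v) = 0"
  proof
    fix g
    show "(solv_bracket k n u (solv_bracket k n v w) + solv_bracket k n v (solv_bracket k n w u) +
      solv_bracket k n w (solv_bracket k n u v)) g = (0 :: generator \<Rightarrow> 'f) g"
    proof (cases g)
      case (E m)
      have nc: "\<not> chain k n 0" using chain_bounds[of k n 0] by auto
      show ?thesis
      proof (cases "chain k n (m - 1)")
        case True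
        then have "m = (m - 1) + 1" using chain_bounds[OF True] by linarith
        then have am: "act k n x m = act k n x (m - 1) + act k n x 1" for x :: "generator \<Rightarrow> 'f"
          using act_chain[OF True, of x] by simp
        show ?thesis
          using True nc
          by (simp add: E solv_bracket_E solv_bracket_closed L Lw am
              del: One_nat_def) (simp add: algebra_simps)
      next
        case False
        then show ?thesis
          by (simp add: E solv_bracket_E solv_bracket_closed L Lw algebra_simps)
      qed
    qed simp
  qed
qed

end

theory Submission
  imports Defs
begin

text \<open>
  The idea is that the algebra has only inner derivations, and that a local derivation, once it
  is corrected by a suitable inner derivation, vanishes on the basis.

  \<^emph>\<open>Derivations are inner.\<close> The element \<open>x\<^sub>1\<close> acts on \<open>e\<^sub>m\<close> with eigenvalue \<open>m\<close>, and in
  characteristic zero these eigenvalues are distinct and nonzero.  Hence the value of a map at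
  \<open>x\<^sub>1\<close>, as soon as it has no \<open>x\<close>-coordinates, is \<open>[x\<^sub>1, v]\<close> for some \<open>v\<close>; the \<open>x\<close>-coordinates
  of \<open>v\<close> remain free and can be chosen to match the diagonal coefficients at \<open>e\<^sub>1\<close> and at the
  first vector of each block (\<open>ex_normalising_bracket\<close>).  What is left of a derivation commutes
  with the action of \<open>x\<^sub>1\<close>, so it is diagonal, and the Leibniz rule carries the vanishing of the
  diagonal down each block (\<open>normalised_derivation_eq_0\<close>).

  \<^emph>\<open>Local derivations.\<close> Let \<open>\<Delta>\<close> be a normalised local derivation.  Then for every \<open>u\<close> there is
  some \<open>v\<close> with \<open>\<Delta> u = [u, v]\<close>, and one looks for elements \<open>u\<close> at which the unknown \<open>v\<close> can be
  eliminated.  They are built from \<open>h = x\<^sub>1 - r x\<^bsub>j+1\<^esub>\<close>, which acts on the vector \<open>e\<^sub>q\<close> of the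
  \<open>j\<close>-th block with eigenvalue \<open>q - r\<close>, hence kills exactly \<open>e\<^sub>r\<close> in that block, while its
  eigenvalue on \<open>e\<^sub>1\<close> is \<open>1\<close>:
  \<^item> \<open>h\<close> itself gives \<open>\<Delta> x\<^bsub>j+1\<^esub> = 0\<close>, since the coordinate of \<open>[h, v]\<close> at \<open>e\<^sub>r\<close> is zero for all \<open>v\<close>;
  \<^item> \<open>h + e\<^sub>m\<close> with \<open>r = m + 1\<close> shows that \<open>\<Delta> e\<^sub>m\<close> has no component at \<open>e\<^bsub>m+1\<^esub>\<close>;
  \<^item> \<open>h + e\<^sub>1\<close> shows, by induction on \<open>r\<close>, that \<open>\<Delta> e\<^sub>1\<close> has no component at \<open>e\<^sub>r\<close>;
  \<^item> \<open>h + e\<^sub>1 + e\<^bsub>r-1\<^esub> - e\<^sub>r\<close> shows that the diagonal coefficients of \<open>\<Delta>\<close> at \<open>e\<^bsub>r-1\<^esub>\<close> and \<open>e\<^sub>r\<close> agree.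
  So \<open>\<Delta>\<close> is diagonal with coefficients that are constant on each block, and these constants are
  zero by the normalisation (\<open>normalised_pointwise_inner_eq_0\<close>).
\<close>

section \<open>Derivations of a Lie algebra\<close>

context lie_algebra
begin

lemma br_skew:
  assumes "u \<in> L" "v \<in> L"
  shows "br u v = - br v u"
proof -
  have "br (u + v) (u + v) = 0"
    using assms by (intro br_self subspace_add[OF subspace_L])
  moreover have "br (u + v) (u + v) = (br u u + br v u) + (br u v + br v v)"
    using assms by (simp only: br_add_left br_add_right subspace_add[OF subspace_L])
  then have "br (u + v) (u + v) = br u v + br v u"
    using assms by (simp only: br_self add_0_left add_0_right add.commute)
  ultimately show ?thesis by (simp only: eq_neg_iff_add_eq_0)
qed

lemma derivation_right_bracket:
  assumes v: "v \<in> L"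
  shows "derivation scale L br (\<lambda>u. br u v)"
  unfolding derivation_def linear_endo_def
proof (intro conjI ballI allI)
  fix u w assume L: "u \<in> L" "w \<in> L"
  have "br u (br w v) + br w (br v u) + br v (br u w) = 0"
    using L v by (intro jacobi)
  then have "br u (br w v) + br w (br v u) = - br v (br u w)"
    by (simp only: eq_neg_iff_add_eq_0)
  moreover have "br (br u w) v = - br v (br u w)" "br (br u v) w = - br w (br u v)"
    using L v by (auto intro!: br_skew br_closed)
  moreover have "br w (br v u) = - br w (br u v)"
    using L v br_skew[of v u] br_scale_right[of w "br u v" "-1"]
    by (simp add: br_closed)
  ultimately show "br (br u w) v = br (br u v) w + br u (br w v)"
    by simp
qed (use v in \<open>simp_all add: br_closed br_add_left br_scale_left\<close>)

lemma derivation_cong: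
  assumes "derivation scale L br d" and eq: "\<And>u. u \<in> L \<Longrightarrow> f u = d u"
  shows "derivation scale L br f"
  using assms(1) unfolding derivation_def linear_endo_def
  by (auto simp: eq br_closed subspace_add[OF subspace_L] subspace_scale[OF subspace_L])

lemma derivation_diff:
  assumes "derivation scale L br d" "derivation scale L br d'"
  shows "derivation scale L br (\<lambda>u. d u - d' u)"
proof -
  have diff: "br (a - b) c = br a c - br b c" "br c (a - b) = br c a - br c b"
    if "a \<in> L" "b \<in> L" "c \<in> L" for a b c
    using br_add_left[of "a - b" b c] br_add_right[of c "a - b" b] that
    by (simp_all add: subspace_diff[OF subspace_L])
  show ?thesis
    using assms
    by (auto simp: derivation_def linear_endo_def diff br_closed scale_right_diff_distrib
        intro!: subspace_diff[OF subspace_L])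
qed

lemma local_derivation_diff:
  assumes "local_derivation scale L br \<Delta>" "derivation scale L br d'"
  shows "local_derivation scale L br (\<lambda>u. \<Delta> u - d' u)"
  unfolding local_derivation_def
proof (intro conjI ballI)
  show "linear_endo scale L (\<lambda>u. \<Delta> u - d' u)"
    using assms
    by (auto simp: local_derivation_def derivation_def linear_endo_def scale_right_diff_distrib
        intro!: subspace_diff[OF subspace_L])
  fix u assume "u \<in> L"
  then obtain d where "derivation scale L br d" "\<Delta> u = d u"
    using assms by (auto simp: local_derivation_def)
  then show "\<exists>d. derivation scale L br d \<and> \<Delta> u - d' u = d u"
    using derivation_diff[OF _ assms(2)] by (intro exI[of _ "\<lambda>u. d u - d' u"]) auto
qed

end

interpretation solv: lie_algebra "fscale :: 'f::field \<Rightarrow> _" "solv_space k n" "solv_bracket k n" for k n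
  by (rule solv_lie_algebra)


section \<open>Linear maps on the solvable algebra\<close>

lemma bvec_apply: "bvec b g = (if g = b then 1 else 0 :: 'f::field)"
  by (simp add: bvec_def)

lemma fscale_apply: "fscale a v g = a * (v g :: 'f::field)"
  by (simp add: fscale_def)

lemma solv_space_add:
  "u \<in> solv_space k n \<Longrightarrow> v \<in> solv_space k n \<Longrightarrow> u + v \<in> (solv_space k n :: (generator \<Rightarrow> 'f::field) set)"
  by (simp add: solv_space_def)

lemma solv_space_diff:
  "u \<in> solv_space k n \<Longrightarrow> v \<in> solv_space k n \<Longrightarrow> u - v \<in> (solv_space k n :: (generator \<Rightarrow> 'f::field) set)"
  by (simp add: solv_space_def)

lemma solv_space_scale:
  "u \<in> solv_space k n \<Longrightarrow> fscale a u \<in> (solv_space k n :: (generator \<Rightarrow> 'f::field) set)"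
  by (simp add: solv_space_def fscale_apply)

lemma bvec_X_mem: "l \<in> {1..k + 1} \<Longrightarrow> bvec (X l) \<in> (solv_space k n :: (generator \<Rightarrow> 'f::field) set)"
  by (auto simp: solv_space_def solv_basis_def bvec_apply)

lemma bvec_E_mem:
  "m \<in> {1..nil_dim k n} \<Longrightarrow> bvec (E m) \<in> (solv_space k n :: (generator \<Rightarrow> 'f::field) set)"
  by (auto simp: solv_space_def solv_basis_def bvec_apply)

lemmas solv_mem = solv_space_add solv_space_diff solv_space_scale bvec_X_mem bvec_E_mem

lemma solv_space_E_eq_0:
  "u \<in> (solv_space k n :: (generator \<Rightarrow> 'f::field) set) \<Longrightarrow> m \<notin> {1..nil_dim k n} \<Longrightarrow> u (E m) = 0"
  by (auto simp: solv_space_def solv_basis_def)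

lemma one_le_nil_dim: "1 \<in> {1..nil_dim k n}"
  by (simp add: nil_dim_def)

lemma linear_endo_add:
  "linear_endo fscale (solv_space k n) f \<Longrightarrow> u \<in> solv_space k n \<Longrightarrow> v \<in> solv_space k n \<Longrightarrow>
    f (u + v) = f u + (f v :: generator \<Rightarrow> 'f::field)"
  by (simp add: linear_endo_def)

lemma linear_endo_scale:
  "linear_endo fscale (solv_space k n) f \<Longrightarrow> u \<in> solv_space k n \<Longrightarrow>
    f (fscale a u) = fscale a (f u :: generator \<Rightarrow> 'f::field)"
  by (simp add: linear_endo_def)

lemma linear_endo_diff:
  assumes "linear_endo fscale (solv_space k n) f" "u \<in> solv_space k n" "v \<in> solv_space k n"
  shows "f (u - v) = f u - (f v :: generator \<Rightarrow> 'f::field)"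
  using linear_endo_add[OF assms(1), of "u - v" v] assms(2,3)
  by (simp add: solv_space_diff)

lemma linear_endo_eq_0:
  assumes f: "linear_endo fscale (solv_space k n) (f :: (generator \<Rightarrow> 'f::field) \<Rightarrow> _)"
    and X: "\<And>l. l \<in> {1..k + 1} \<Longrightarrow> f (bvec (X l)) = 0"
    and E: "\<And>m. m \<in> {1..nil_dim k n} \<Longrightarrow> f (bvec (E m)) = 0"
    and u: "u \<in> solv_space k n"
  shows "f u = 0"
proof -
  have b: "bvec b \<in> solv_space k n \<and> f (bvec b) = 0" if "b \<in> solv_basis k n" for b
    using that X E by (auto simp: solv_basis_def bvec_X_mem bvec_E_mem)
  have zero: "f 0 = 0"
    using linear_endo_diff[OF f u u] by simp
  have "(\<Sum>b\<in>B. fscale (u b) (bvec b)) \<in> solv_space k n \<and> f (\<Sum>b\<in>B. fscale (u b) (bvec b)) = 0"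
    if "finite B" "B \<subseteq> solv_basis k n" for B
    using that
  proof (induction B)
    case empty
    then show ?case using zero by (auto simp: solv_space_def zero_fun_def)
  next
    case (insert c B)
    let ?s = "\<Sum>b\<in>B. fscale (u b) (bvec b)"
    have mem: "fscale (u c) (bvec c) \<in> solv_space k n" "?s \<in> solv_space k n"
      and c: "bvec c \<in> solv_space k n" "f (bvec c) = 0" "f ?s = 0"
      using b[of c] insert by (auto intro: solv_space_scale)
    have "f (fscale (u c) (bvec c) + ?s) = 0"
      unfolding linear_endo_add[OF f mem] linear_endo_scale[OF f c(1)] c
      by (simp add: fscale_apply fun_eq_iff)
    then show ?case
      unfolding sum.insert[OF insert(1,2)] using solv_space_add[OF mem] by blast
  qed
  moreover have "u = (\<Sum>b\<in>solv_basis k n. fscale (u b) (bvec b))"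
    using u by (auto simp: fun_eq_iff sum_fun_apply fscale_apply bvec_apply solv_space_def
        if_distrib[of "\<lambda>x. _ * x"] cong: if_cong)
  ultimately show ?thesis by (metis finite_solv_basis order_refl)
qed


section \<open>Blocks and weights\<close>

definition block :: "(nat \<Rightarrow> nat) \<Rightarrow> nat \<Rightarrow> nat set"
  where "block n j = {offset n j + 2..offset n (Suc j) + 1}"

lemma block_range:
  assumes "j \<in> {1..k}" "m \<in> block n j"
  shows "2 \<le> m" "m \<in> {1..nil_dim k n}"
  using assms offset_mono[of "Suc j" "Suc k" n] by (auto simp: block_def nil_dim_offset)

lemma block_disjoint:
  assumes "m \<in> block n i" "m \<in> block n j"
  shows "i = j"
  using assms offset_mono[of "Suc i" j n] offset_mono[of "Suc j" i n]
  by (cases i j rule: linorder_cases) (auto simp: block_def)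

lemma ex_block:
  assumes "2 \<le> m" "m \<le> nil_dim k n"
  shows "\<exists>j\<in>{1..k}. m \<in> block n j"
proof -
  have "2 \<le> m \<Longrightarrow> m \<le> offset n (Suc k) + 1 \<Longrightarrow> \<exists>j\<in>{1..k}. m \<in> block n j"
  proof (induction k)
    case 0
    then show ?case by (simp add: offset_def)
  next
    case (Suc k)
    show ?case
    proof (cases "m \<le> offset n (Suc k) + 1")
      case True
      then show ?thesis using Suc by fastforce
    next
      case False
      then have "m \<in> block n (Suc k)" using Suc.prems by (simp add: block_def)
      then show ?thesis by auto
    qed
  qed
  then show ?thesis using assms by (simp add: nil_dim_offset)
qed

lemma chain_iff_block:
  assumes "j \<in> {1..k}" "m + 1 \<in> block n j"
  shows "chain k n m \<longleftrightarrow> m \<in> block n j"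
proof
  assume "chain k n m"
  then obtain i where i: "i \<in> {1..k}" "m \<in> block n i" "m + 1 \<in> block n i"
    by (auto simp: chain_def block_def offset_Suc)
  then show "m \<in> block n j" using block_disjoint[of "m + 1" n i j] assms by simp
next
  assume m: "m \<in> block n j"
  then have "m = offset n j + (m - offset n j)" "m - offset n j \<in> {2..n j}"
    using assms by (auto simp: block_def offset_Suc)
  then show "chain k n m" using assms(1) unfolding chain_def by blast
qed

lemma block_induct [consumes 1, case_names first step]:
  assumes "m \<in> block n j"
    and "P (offset n j + 2)"
    and "\<And>m. m \<in> block n j \<Longrightarrow> m + 1 \<in> block n j \<Longrightarrow> P m \<Longrightarrow> P (m + 1)"
  shows "P m"
proof -
  have "offset n j + 2 \<le> m" using assms(1) by (simp add: block_def)
  then show ?thesis using assms(1)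
  proof (induction m rule: dec_induct)
    case base
    then show ?case using assms(2) by simp
  next
    case (step m)
    then show ?case using assms(3)[of m] by (simp add: block_def)
  qed
qed

lemma act_add: "act k n (u + v) m = act k n u m + (act k n v m :: 'f::field)"
  by (simp add: act_def sum.distrib distrib_right)

lemma act_diff: "act k n (u - v) m = act k n u m - (act k n v m :: 'f::field)"
  by (simp add: act_def sum_subtractf left_diff_distrib)

lemma act_E: "act k n (bvec (E p)) m = (0 :: 'f::field)"
  by (simp add: act_def bvec_apply)

lemma act_X: "l \<in> {1..k + 1} \<Longrightarrow> act k n (bvec (X l)) m = (wt k n l m :: 'f::field)"
  by (simp add: act_def bvec_apply if_distrib[of "\<lambda>x. x * _"] cong: if_cong del: sum.cl_ivl_Suc)

lemma wt_X1: "wt k n 1 m = (of_nat m :: 'f::field)"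
  by (simp add: wt_def)

lemma wt_block:
  assumes "j \<in> {1..k}"
  shows "wt k n (j + 1) m = (if m \<in> block n j then 1 else 0 :: 'f::field)"
proof -
  have "j + 1 \<noteq> 1" "j + 1 - 1 = j" "1 \<le> j" using assms by auto
  then show ?thesis unfolding wt_def block_def using in_block_iff[of j n m] by (auto simp del: One_nat_def)
qed

lemma act_split:
  "act k n v m = v (X 1) * of_nat m + (\<Sum>j = 1..k. v (X (j + 1)) * wt k n (j + 1) m :: 'f::field)"
proof -
  have "act k n v m = v (X 1) * wt k n 1 m + (\<Sum>l = Suc 1..Suc k. v (X l) * wt k n l m)"
    unfolding act_def by (simp add: sum.atLeast_Suc_atMost del: sum.cl_ivl_Suc)
  also have "\<dots> = v (X 1) * wt k n 1 m + (\<Sum>j = 1..k. v (X (Suc j)) * wt k n (Suc j) m)"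
    by (simp only: sum.shift_bounds_cl_Suc_ivl)
  finally show ?thesis unfolding wt_X1 Suc_eq_plus1 .
qed

text \<open>
  On the \<open>j\<close>-th block only \<open>x\<^sub>1\<close> and \<open>x\<^bsub>j+1\<^esub>\<close> act, so the torus eigenvalues there form an
  arithmetic progression whose step \<open>v (X 1)\<close> is shared by all blocks and whose start is free.
\<close>

lemma act_block:
  assumes "j \<in> {1..k}" "m \<in> block n j"
  shows "act k n v m = (v (X 1) * of_nat m + v (X (j + 1)) :: 'f::field)"
proof -
  have wt: "wt k n (i + 1) m = (if i = j then 1 else 0 :: 'f)" if "i \<in> {1..k}" for i
    unfolding wt_block[OF that] using assms(2) block_disjoint[OF _ assms(2)] by metis
  have "(\<Sum>i = 1..k. v (X (i + 1)) * wt k n (i + 1) m) =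
      (\<Sum>i = 1..k. if i = j then v (X (i + 1)) else 0 :: 'f)"
    by (intro sum.cong refl) (simp only: wt if_distrib[of "\<lambda>x. _ * x"] mult_1_right mult_zero_right)
  also have "\<dots> = v (X (j + 1))"
    unfolding sum.delta[OF finite_atLeastAtMost] using assms(1) by simp
  finally show ?thesis by (simp only: act_split)
qed

lemma act_1: "act k n v 1 = (v (X 1) :: 'f::field)"
proof -
  have "(\<Sum>i = 1..k. v (X (i + 1)) * wt k n (i + 1) 1) = (\<Sum>i = 1..k. 0 :: 'f)"
    by (intro sum.cong refl) (auto simp: wt_block block_def simp del: One_nat_def)
  then show ?thesis by (simp only: act_split sum.neutral_const of_nat_1 mult_1_right add_0_right)
qed

lemma not_chain [simp]: "\<not> chain k n 0" "\<not> chain k n 1" "\<not> chain k n (Suc 0)"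
  using chain_bounds[of k n 0] chain_bounds[of k n 1] by auto

lemma bracket_E_diag:
  assumes "m \<in> {1..nil_dim k n}" "v \<in> solv_space k n"
  shows "solv_bracket k n (bvec (E m)) v (E m) = (act k n v m :: 'f::field)"
  using assms by (cases "m = 1") (auto simp: solv_bracket_E solv_mem act_E bvec_apply)


section \<open>Normalised maps\<close>

text \<open>
  These are the coefficients that subtracting an inner derivation removes.  A map is only
  required to vanish on the diagonal at \<open>e\<^sub>1\<close> and at the first vectors of the blocks, because these
  generate the nilradical and the torus has just one free eigenvalue for each of them.
\<close>

definition normalised :: "nat \<Rightarrow> (nat \<Rightarrow> nat) \<Rightarrow> ((generator \<Rightarrow> 'f::field) \<Rightarrow> generator \<Rightarrow> 'f) \<Rightarrow> bool"
  where "normalised k n f \<longleftrightarrow>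
    f (bvec (X 1)) = 0 \<and> f (bvec (E 1)) (E 1) = 0 \<and>
    (\<forall>j\<in>{1..k}. f (bvec (E (offset n j + 2))) (E (offset n j + 2)) = 0)"

text \<open>
  The \<open>e\<close>-coordinates of \<open>v\<close> solve \<open>[x\<^sub>1, v] = f x\<^sub>1\<close>, which is possible as \<open>x\<^sub>1\<close> acts invertibly on
  the nilradical.  The \<open>x\<close>-coordinates do not enter this equation and are left to prescribe the
  eigenvalues of \<open>v\<close> at the generators.
\<close>

lemma ex_normalising_bracket:
  fixes f :: "(generator \<Rightarrow> 'f::field_char_0) \<Rightarrow> generator \<Rightarrow> 'f"
  assumes pos: "\<forall>j\<in>{1..k}. 1 \<le> n j"
    and f: "linear_endo fscale (solv_space k n) f"
    and fX: "\<And>l. f (bvec (X 1)) (X l) = 0"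
  shows "\<exists>v\<in>solv_space k n. normalised k n (\<lambda>u. f u - solv_bracket k n u v)"
proof -
  define b where "b m = f (bvec (E m)) (E m)" for m
  define v where "v g = (case g of
      X l \<Rightarrow> if l = 1 then b 1
             else if l \<in> {2..k + 1} then b (offset n (l - 1) + 2) - of_nat (offset n (l - 1) + 2) * b 1
             else 0
    | E m \<Rightarrow> - f (bvec (X 1)) (E m) / of_nat m)" for g
  have x1: "bvec (X 1) \<in> (solv_space k n :: (generator \<Rightarrow> 'f) set)" by (intro bvec_X_mem) simp
  then have fx1: "f (bvec (X 1)) \<in> solv_space k n" using f by (simp add: linear_endo_def)
  have f0: "f (bvec (X 1)) (E m) = 0" if "m \<notin> {1..nil_dim k n}" for m
    using that by (rule solv_space_E_eq_0[OF fx1])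
  have v: "v \<in> solv_space k n"
    by (auto simp: solv_space_def solv_basis_def v_def image_iff split: generator.splits intro!: f0[simplified])
  have X1: "(f (bvec (X 1)) - solv_bracket k n (bvec (X 1)) v) g = 0 g" for g
  proof (cases g)
    case (E m)
    have "solv_bracket k n (bvec (X 1)) v (E m) = - (v (E m) * of_nat m)"
      using x1 v by (simp add: solv_bracket_E act_X wt_X1[simplified]) (simp add: bvec_apply)
    also have "\<dots> = f (bvec (X 1)) (E m)"
      using f0[of 0] by (cases "m = 0") (auto simp: v_def)
    finally show ?thesis using E by simp
  qed (simp add: fX[simplified])
  have E1: "b 1 - act k n v 1 = 0"
    unfolding act_1 by (simp add: v_def)
  have first: "b (offset n j + 2) - act k n v (offset n j + 2) = 0"
    "offset n j + 2 \<in> {1..nil_dim k n}" if j: "j \<in> {1..k}" for j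
  proof -
    have m: "offset n j + 2 \<in> block n j"
      using j pos by (auto simp: block_def offset_Suc)
    show "b (offset n j + 2) - act k n v (offset n j + 2) = 0"
      using j unfolding act_block[OF j m] by (simp add: v_def)
    show "offset n j + 2 \<in> {1..nil_dim k n}" by (rule block_range[OF j m])
  qed
  have "normalised k n (\<lambda>u. f u - solv_bracket k n u v)"
    unfolding normalised_def
  proof (intro conjI ballI)
    show "f (bvec (X 1)) - solv_bracket k n (bvec (X 1)) v = 0"
      by (rule ext) (rule X1)
    show "(f (bvec (E 1)) - solv_bracket k n (bvec (E 1)) v) (E 1) = 0"
      using E1 unfolding minus_apply bracket_E_diag[OF one_le_nil_dim v] b_def .
    fix j assume j: "j \<in> {1..k}"
    show "(f (bvec (E (offset n j + 2))) - solv_bracket k n (bvec (E (offset n j + 2))) v)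
        (E (offset n j + 2)) = 0"
      using first(1)[OF j] unfolding minus_apply bracket_E_diag[OF first(2)[OF j] v] b_def .
  qed
  then show ?thesis using v by blast
qed

text \<open>The common end of both vanishing proofs: normalised coefficients propagate down the blocks.\<close>

lemma diagonal_eq_0:
  assumes "normalised k n (f :: (generator \<Rightarrow> 'f::field) \<Rightarrow> _)"
    and step: "\<And>m. chain k n m \<Longrightarrow> f (bvec (E (m + 1))) (E (m + 1)) = f (bvec (E m)) (E m)"
    and m: "m \<in> {1..nil_dim k n}"
  shows "f (bvec (E m)) (E m) = 0"
proof (cases "m = 1")
  case True
  then show ?thesis using assms(1) by (simp add: normalised_def)
next
  case False
  then obtain j where j: "j \<in> {1..k}" "m \<in> block n j" using ex_block[of m k n] m by auto
  from j(2) show ?thesis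
  proof (induction rule: block_induct)
    case first
    then show ?case using assms(1) j(1) by (simp add: normalised_def)
  next
    case (step m)
    then show ?case using assms(2)[of m] chain_iff_block[OF j(1) step(2)] by simp
  qed
qed


section \<open>Every derivation is inner\<close>

lemma table_E_1: "chain k n m \<Longrightarrow> table k n (E m) (E 1) - table k n (E 1) (E m) = (bvec (E (m + 1)) :: generator \<Rightarrow> 'f::field)"
  using chain_bounds[of k n m] by (auto simp: chain_def)

lemma bracket_chain:
  assumes "chain k n m"
  shows "solv_bracket k n (bvec (E m)) (bvec (E 1)) = (bvec (E (m + 1)) :: generator \<Rightarrow> 'f::field)"
  using chain_bounds[OF assms] table_E_1[OF assms] one_le_nil_dim[of k n]
  by (subst solv_bracket_bvec) (auto simp: solv_basis_def)

lemma bracket_E_X: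
  assumes "m \<in> {1..nil_dim k n}" "l \<in> {1..k + 1}"
  shows "solv_bracket k n (bvec (E m)) (bvec (X l)) = (fscale (wt k n l m) (bvec (E m)) :: generator \<Rightarrow> 'f::field)"
proof
  fix g
  show "solv_bracket k n (bvec (E m)) (bvec (X l)) g = (fscale (wt k n l m) (bvec (E m)) :: generator \<Rightarrow> 'f) g"
    using assms by (cases g) (auto simp: solv_bracket_E solv_mem act_E act_X fscale_apply bvec_apply)
qed

lemma derivation_linear: "derivation scale L br d \<Longrightarrow> linear_endo scale L d"
  by (simp add: derivation_def)

text \<open>
  Differentiating \<open>[e\<^sub>m, x\<^sub>l] = wt l m \<cdot> e\<^sub>m\<close> and comparing the coefficients of \<open>e\<^sub>m\<close>, the unknown
  \<open>d e\<^sub>m\<close> cancels and the eigenvalue of \<open>d x\<^sub>l\<close> at \<open>e\<^sub>m\<close> comes out as zero.  As every block is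
  nonempty, an element of the torus is determined by its eigenvalues.
\<close>

lemma derivation_X_coords:
  fixes d :: "(generator \<Rightarrow> 'f::field_char_0) \<Rightarrow> generator \<Rightarrow> 'f"
  assumes pos: "\<forall>j\<in>{1..k}. 1 \<le> n j"
    and d: "derivation fscale (solv_space k n) (solv_bracket k n) d"
    and l: "l \<in> {1..k + 1}"
  shows "d (bvec (X l)) (X i) = 0"
proof -
  let ?w = "d (bvec (X l))"
  have xl: "bvec (X l) \<in> (solv_space k n :: (generator \<Rightarrow> 'f) set)" using l by (rule bvec_X_mem)
  then have w: "?w \<in> solv_space k n" using d by (simp add: derivation_def linear_endo_def)
  have act: "act k n ?w m = 0" if m: "m \<in> {1..nil_dim k n}" for m
  proof -
    have e: "bvec (E m) \<in> (solv_space k n :: (generator \<Rightarrow> 'f) set)" using m by (rule bvec_E_mem)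
    then have de: "d (bvec (E m)) \<in> solv_space k n" using d by (simp add: derivation_def linear_endo_def)
    have "fscale (wt k n l m) (d (bvec (E m))) =
        solv_bracket k n (d (bvec (E m))) (bvec (X l)) + solv_bracket k n (bvec (E m)) ?w"
      using d e xl bracket_E_X[OF m l, where 'f = 'f]
      by (simp add: derivation_def linear_endo_def) metis
    then have "fscale (wt k n l m) (d (bvec (E m))) (E m) =
        solv_bracket k n (d (bvec (E m))) (bvec (X l)) (E m) + solv_bracket k n (bvec (E m)) ?w (E m)"
      by simp
    moreover have "solv_bracket k n (d (bvec (E m))) (bvec (X l)) (E m) = wt k n l m * d (bvec (E m)) (E m)"
      using de xl l by (simp add: solv_bracket_E act_X) (simp add: bvec_apply)
    ultimately show ?thesis using bracket_E_diag[OF m w] by (simp add: fscale_apply)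
  qed
  have 1: "?w (X 1) = 0" using act[OF one_le_nil_dim] by (simp only: act_1)
  show ?thesis
  proof (cases "i \<in> {2..k + 1}")
    case True
    define j where "j = i - 1"
    have j: "j \<in> {1..k}" "i = j + 1" using True by (auto simp: j_def)
    have m: "offset n j + 2 \<in> block n j"
      using j pos by (auto simp: block_def offset_Suc)
    show ?thesis using act[OF block_range(2)[OF j(1) m]] 1 unfolding act_block[OF j(1) m] j(2) by simp
  next
    case False
    then have "i = 1 \<or> X i \<notin> solv_basis k n" by (auto simp: solv_basis_def)
    then show ?thesis using 1 w by (auto simp: solv_space_def)
  qed
qed

lemma eigenvector_X1:
  fixes w :: "generator \<Rightarrow> 'f::field_char_0"
  assumes w: "w \<in> solv_space k n"
    and eig: "solv_bracket k n w (bvec (X 1)) = fscale (of_nat m) w" and p: "p \<noteq> m"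
  shows "w (E p) = 0"
proof -
  have "solv_bracket k n w (bvec (X 1)) (E p) = w (E p) * of_nat p"
    using w by (simp add: solv_bracket_E solv_mem act_X wt_X1[simplified]) (simp add: bvec_apply)
  moreover have "solv_bracket k n w (bvec (X 1)) (E p) = w (E p) * of_nat m"
    unfolding eig by (simp add: fscale_apply)
  ultimately have "w (E p) * of_nat p = w (E p) * of_nat m" by (simp only:)
  then show ?thesis using p by auto
qed

text \<open>
  Since \<open>d x\<^sub>1 = 0\<close>, the map \<open>d\<close> preserves the eigenspaces of \<open>x\<^sub>1\<close>.  Those with nonzero eigenvalue
  are the lines spanned by the \<open>e\<^sub>m\<close>; the one with eigenvalue zero is the torus, on which \<open>d\<close>
  vanishes because the \<open>d x\<^sub>l\<close> have no \<open>x\<close>-coordinates.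
\<close>

lemma normalised_derivation_eq_0:
  fixes d :: "(generator \<Rightarrow> 'f::field_char_0) \<Rightarrow> generator \<Rightarrow> 'f"
  assumes pos: "\<forall>j\<in>{1..k}. 1 \<le> n j"
    and d: "derivation fscale (solv_space k n) (solv_bracket k n) d"
    and norm: "normalised k n d"
    and u: "u \<in> solv_space k n"
  shows "d u = 0"
proof -
  let ?L = "solv_space k n :: (generator \<Rightarrow> 'f) set"
  have lin: "linear_endo fscale ?L d" using d by (rule derivation_linear)
  have dL: "d w \<in> ?L" if "w \<in> ?L" for w using that lin by (simp add: linear_endo_def)
  have x1: "bvec (X 1) \<in> ?L" by (intro bvec_X_mem) simp
  have dx1: "d (bvec (X 1)) = 0" using norm by (simp add: normalised_def)
  have leib: "d (solv_bracket k n w (bvec (X 1))) = solv_bracket k n (d w) (bvec (X 1))" if "w \<in> ?L" for w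
  proof -
    have "solv_bracket k n w 0 = (0 :: generator \<Rightarrow> 'f)"
      by (simp add: solv_bracket_def fscale_apply fun_eq_iff sum_fun_apply)
    then show ?thesis using d that x1 dx1 by (simp add: derivation_def)
  qed
  have E_coord: "d (bvec (E m)) (E p) = 0" if m: "m \<in> {1..nil_dim k n}" and p: "p \<noteq> m" for m p
  proof (rule eigenvector_X1[OF dL _ p])
    show e: "bvec (E m) \<in> ?L" using m by (rule bvec_E_mem)
    show "solv_bracket k n (d (bvec (E m))) (bvec (X 1)) = fscale (of_nat m) (d (bvec (E m)))"
      using leib[OF e] bracket_E_X[OF m, of 1, where 'f = 'f] linear_endo_scale[OF lin e, of "of_nat m"]
      by (simp add: wt_X1[simplified])
  qed
  have E_X: "d (bvec (E m)) (X i) = 0" if m: "m \<in> {1..nil_dim k n}" for m i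
  proof -
    have e: "bvec (E m) \<in> ?L" using m by (rule bvec_E_mem)
    have "fscale (of_nat m) (d (bvec (E m))) = solv_bracket k n (d (bvec (E m))) (bvec (X 1))"
      using leib[OF e] bracket_E_X[OF m, of 1, where 'f = 'f] linear_endo_scale[OF lin e, of "of_nat m"]
      by (simp add: wt_X1[simplified])
    then have "fscale (of_nat m) (d (bvec (E m))) (X i) = 0" by simp
    then show ?thesis using m by (simp add: fscale_apply)
  qed
  have diag: "d (bvec (E m)) = fscale (d (bvec (E m)) (E m)) (bvec (E m))" if "m \<in> {1..nil_dim k n}" for m
  proof
    fix g
    show "d (bvec (E m)) g = fscale (d (bvec (E m)) (E m)) (bvec (E m)) g"
      using that by (cases g) (auto simp: E_coord E_X fscale_apply bvec_apply)
  qed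
  have diag_0: "d (bvec (E m)) = 0" if "m \<in> {1..nil_dim k n}" "d (bvec (E m)) (E m) = 0" for m
    by (rule trans[OF diag[OF that(1)]]) (simp add: that(2) fscale_apply fun_eq_iff)
  show ?thesis
  proof (rule linear_endo_eq_0[OF lin _ _ u])
    fix l assume l: "l \<in> {1..k + 1}"
    have xl: "bvec (X l) \<in> ?L" using l by (rule bvec_X_mem)
    have xx: "solv_bracket k n (bvec (X l)) (bvec (X 1)) = (0 :: generator \<Rightarrow> 'f)"
      using l by (subst solv_bracket_bvec) (auto simp: solv_basis_def)
    have "d 0 = 0" using linear_endo_diff[OF lin u u] by simp
    moreover have scale_0: "fscale (of_nat 0) w = 0" for w :: "generator \<Rightarrow> 'f"
      by (simp add: fscale_apply fun_eq_iff)
    ultimately have eig: "solv_bracket k n (d (bvec (X l))) (bvec (X 1)) = fscale (of_nat 0) (d (bvec (X l)))"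
      using leib[OF xl] xx scale_0 by metis
    show "d (bvec (X l)) = 0"
    proof
      fix g
      show "d (bvec (X l)) g = 0 g"
      proof (cases g)
        case (X i)
        then show ?thesis using derivation_X_coords[OF pos d l] by simp
      next
        case (E p)
        then show ?thesis
          using eigenvector_X1[OF dL[OF xl] eig, of p] solv_space_E_eq_0[OF dL[OF xl], of p]
          by (cases "p = 0") auto
      qed
    qed
  next
    fix m assume m: "m \<in> {1..nil_dim k n}"
    have "d (bvec (E m)) (E m) = 0"
    proof (rule diagonal_eq_0[OF norm _ m])
      fix m assume c: "chain k n m"
      have r: "m \<in> {1..nil_dim k n}" "m + 1 \<in> {1..nil_dim k n}" "m \<noteq> 1"
        using chain_bounds[OF c] by auto
      have e: "bvec (E m) \<in> ?L" "bvec (E 1) \<in> ?L" using r one_le_nil_dim by (auto intro: bvec_E_mem)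
      have leib1: "d (solv_bracket k n (bvec (E m)) (bvec (E 1))) =
          solv_bracket k n (d (bvec (E m))) (bvec (E 1)) + solv_bracket k n (bvec (E m)) (d (bvec (E 1)))"
        using d e unfolding derivation_def by blast
      have "d (bvec (E 1)) = 0"
        using norm by (intro diag_0[OF one_le_nil_dim]) (simp add: normalised_def)
      moreover have "solv_bracket k n (bvec (E m)) 0 = (0 :: generator \<Rightarrow> 'f)"
        by (simp add: solv_bracket_def fscale_apply fun_eq_iff sum_fun_apply)
      ultimately have "d (bvec (E (m + 1))) = solv_bracket k n (d (bvec (E m))) (bvec (E 1))"
        using leib1 by (simp only: bracket_chain[OF c] add_0_right)
      also have "\<dots> = solv_bracket k n (fscale (d (bvec (E m)) (E m)) (bvec (E m))) (bvec (E 1))"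
        by (rule arg_cong[OF diag[OF r(1)], of "\<lambda>w. solv_bracket k n w (bvec (E 1))"])
      also have "\<dots> = fscale (d (bvec (E m)) (E m)) (bvec (E (m + 1)))"
        by (simp only: solv.br_scale_left[OF e] bracket_chain[OF c])
      finally show "d (bvec (E (m + 1))) (E (m + 1)) = d (bvec (E m)) (E m)"
        by (simp add: fscale_apply bvec_apply fun_eq_iff)
    qed
    then show "d (bvec (E m)) = 0" by (rule diag_0[OF m])
  qed
qed

lemma derivation_inner:
  fixes d :: "(generator \<Rightarrow> 'f::field_char_0) \<Rightarrow> generator \<Rightarrow> 'f"
  assumes pos: "\<forall>j\<in>{1..k}. 1 \<le> n j"
    and d: "derivation fscale (solv_space k n) (solv_bracket k n) d"
  shows "\<exists>v\<in>solv_space k n. \<forall>u\<in>solv_space k n. d u = solv_bracket k n u v"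
proof -
  obtain v where v: "v \<in> solv_space k n" "normalised k n (\<lambda>u. d u - solv_bracket k n u v)"
    using ex_normalising_bracket[OF pos derivation_linear[OF d]] derivation_X_coords[OF pos d, of 1]
    by auto
  have "d u - solv_bracket k n u v = 0" if "u \<in> solv_space k n" for u
    using normalised_derivation_eq_0[OF pos
        solv.derivation_diff[OF d solv.derivation_right_bracket[OF v(1)]] v(2) that] .
  then show ?thesis using v(1) by auto
qed


section \<open>Local derivations\<close>

text \<open>
  An element of the torus that annihilates \<open>e\<^sub>r\<close> and nothing else in the \<open>j\<close>-th block, without
  annihilating \<open>e\<^sub>1\<close>.
\<close>

definition probe :: "nat \<Rightarrow> nat \<Rightarrow> generator \<Rightarrow> 'f::field"
  where "probe j r = bvec (X 1) - fscale (of_nat r) (bvec (X (j + 1)))"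

lemma probe_mem: "j \<in> {1..k} \<Longrightarrow> probe j r \<in> (solv_space k n :: (generator \<Rightarrow> 'f::field) set)"
  unfolding probe_def by (intro solv_mem) auto

lemma probe_E: "probe j r (E m) = (0 :: 'f::field)"
  by (simp add: probe_def bvec_apply fscale_apply)

lemma act_probe:
  assumes "j \<in> {1..k}" "m \<in> block n j"
  shows "act k n (probe j r) m = (of_nat m - of_nat r :: 'f::field)"
  using assms by (simp add: act_block) (auto simp: probe_def bvec_apply fscale_apply)

lemma act_probe_1: "j \<in> {1..k} \<Longrightarrow> act k n (probe j r) 1 = (1 :: 'f::field)"
  unfolding act_1 by (auto simp: probe_def bvec_apply fscale_apply)

text \<open>
  If \<open>u\<close> is \<open>probe j r + e\<^sub>1\<close>, up to terms of index at least \<open>p\<close>, and \<open>[u, v]\<close> has no coordinates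
  in the block below \<open>p\<close>, then the coordinates of \<open>v\<close> satisfy this recurrence.  Its leading
  factors \<open>q - r\<close> do not vanish below \<open>r\<close>, so \<open>v\<close> is zero there.
\<close>

lemma block_recurrence_eq_0:
  fixes v :: "generator \<Rightarrow> 'f::field_char_0"
  assumes rec: "\<And>q. q \<in> block n j \<Longrightarrow> q < p \<Longrightarrow>
      v (E q) * (of_nat q - of_nat r) + (if q - 1 \<in> block n j then v (E (q - 1)) else 0) = 0"
    and "p \<le> r" "q \<in> block n j" "q < p"
  shows "v (E q) = 0"
  using \<open>q \<in> block n j\<close> \<open>q < p\<close>
proof (induction rule: block_induct)
  case first
  have "offset n j + 2 \<in> block n j" using assms(3) by (simp add: block_def)
  moreover have "offset n j + 2 - 1 \<notin> block n j" by (simp add: block_def)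
  ultimately have "v (E (offset n j + 2)) * (of_nat (offset n j + 2) - of_nat r) = 0"
    using rec[OF _ first] by simp
  then show ?case
    using first \<open>p \<le> r\<close> unfolding mult_eq_0_iff right_minus_eq of_nat_eq_iff by auto
next
  case (step m)
  then have "v (E (m + 1)) * (of_nat (m + 1) - of_nat r) = 0"
    using rec[OF step(2)] by simp
  then show ?case
    using step.prems \<open>p \<le> r\<close> unfolding mult_eq_0_iff right_minus_eq of_nat_eq_iff by auto
qed

text \<open>
  Each step picks a test element \<open>u\<close> made from a probe and compares coordinates in
  \<open>f u = [u, v]\<close>.  Although \<open>v\<close> depends on \<open>u\<close>, the values of \<open>f\<close> at the summands of \<open>u\<close> do not, and
  that is what links the different points.
\<close>

lemma normalised_pointwise_inner_eq_0:
  fixes f :: "(generator \<Rightarrow> 'f::field_char_0) \<Rightarrow> generator \<Rightarrow> 'f"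
  assumes lin: "linear_endo fscale (solv_space k n) f"
    and inner: "\<And>u. u \<in> solv_space k n \<Longrightarrow> \<exists>v\<in>solv_space k n. f u = solv_bracket k n u v"
    and norm: "normalised k n f"
    and u: "u \<in> solv_space k n"
  shows "f u = 0"
proof -
  let ?L = "solv_space k n :: (generator \<Rightarrow> 'f) set"
  have x1: "bvec (X 1) \<in> ?L" and e1: "bvec (E 1) \<in> ?L"
    using one_le_nil_dim by (auto intro: bvec_X_mem bvec_E_mem)
  have fx1: "f (bvec (X 1)) = 0" using norm by (simp add: normalised_def)
  have f_X: "f w (X i) = 0" if "w \<in> ?L" for w i
    using inner[OF that] by auto
  have prev: "chain k n (q - 1) \<longleftrightarrow> q - 1 \<in> block n j" if "j \<in> {1..k}" "q \<in> block n j" for j q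
    using chain_iff_block[of j k "q - 1" n] that block_range(1)[OF that] by simp

  have fx: "f (bvec (X (j + 1))) = 0" if j: "j \<in> {1..k}" for j
  proof
    fix g
    have xl: "bvec (X (j + 1)) \<in> ?L" using j by (intro bvec_X_mem) simp
    show "f (bvec (X (j + 1))) g = 0 g"
    proof (cases g)
      case (X i)
      then show ?thesis using f_X[OF xl] by simp
    next
      case (E r)
      show ?thesis
      proof (cases "r \<in> block n j")
        case True
        obtain v where v: "v \<in> ?L" "f (probe j r) = solv_bracket k n (probe j r) v"
          using inner[OF probe_mem[OF j]] by auto
        \<comment> \<open>The probe annihilates \<open>e\<^sub>r\<close>, so the coordinate of its bracket there vanishes for every \<open>v\<close>.\<close>
        have "f (probe j r) = - fscale (of_nat r) (f (bvec (X (j + 1))))"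
          using x1 xl fx1 unfolding probe_def
          by (simp add: linear_endo_diff[OF lin] linear_endo_scale[OF lin] solv_mem)
        moreover have "solv_bracket k n (probe j r) v (E r) = 0"
          using v(1) by (simp add: solv_bracket_E probe_mem[OF j] probe_E act_probe[OF j True])
        ultimately have "of_nat r * f (bvec (X (j + 1))) (E r) = 0"
          using v(2) by (metis fscale_apply fun_Compl_def neg_equal_0_iff_equal)
        then show ?thesis using E block_range(1)[OF j True] by simp
      next
        case False
        obtain v where v: "v \<in> ?L" "f (bvec (X (j + 1))) = solv_bracket k n (bvec (X (j + 1))) v"
          using inner[OF xl] by auto
        have "act k n (bvec (X (j + 1))) r = (0 :: 'f)"
          using j False wt_block[OF j, of n r, where 'f = 'f] by (simp add: act_X)
        then show ?thesis unfolding v(2) E solv_bracket_E[OF xl v(1)] by (simp add: bvec_apply)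
      qed
    qed
  qed
  have f_probe: "f (probe j r) = 0" if j: "j \<in> {1..k}" for j r
  proof -
    have "bvec (X (j + 1)) \<in> ?L" using j by (intro bvec_X_mem) simp
    then show ?thesis
      using x1 fx1 fx[OF j] unfolding probe_def
      by (simp add: linear_endo_diff[OF lin] linear_endo_scale[OF lin] solv_mem)
  qed

  have off_diag: "f (bvec (E m)) (E p) = 0"
    if m: "m \<in> {1..nil_dim k n}" "m \<noteq> 1" and p: "p \<noteq> m" for m p
  proof -
    have e: "bvec (E m) \<in> ?L" using m(1) by (rule bvec_E_mem)
    obtain w where w: "w \<in> ?L" "f (bvec (E m)) = solv_bracket k n (bvec (E m)) w"
      using inner[OF e] by auto
    have gen: "f (bvec (E m)) (E p) = 0" if "p \<noteq> m" "\<not> (chain k n m \<and> p = m + 1)" for p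
      using that m unfolding w(2) solv_bracket_E[OF e w(1)] by (auto simp: bvec_apply act_E)
    show ?thesis
    proof (cases "chain k n m \<and> p = m + 1")
      case True
      then have "m + 1 \<le> nil_dim k n" "2 \<le> m + 1" using chain_bounds[of k n m] by auto
      then obtain j where j: "j \<in> {1..k}" "m + 1 \<in> block n j" using ex_block by blast
      \<comment> \<open>The coordinate at \<open>e\<^bsub>m+1\<^esub>\<close> can only be \<open>v (E 1)\<close>, as the probe annihilates \<open>e\<^bsub>m+1\<^esub>\<close>; the
        coordinate at \<open>e\<^sub>1\<close> forces \<open>v (E 1)\<close> to vanish, as the probe does not annihilate \<open>e\<^sub>1\<close>.\<close>
      let ?u = "probe j (m + 1) + bvec (E m) :: generator \<Rightarrow> 'f"
      have mem: "?u \<in> ?L" by (intro solv_space_add e probe_mem j(1))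
      obtain v where v: "v \<in> ?L" "f ?u = solv_bracket k n ?u v"
        using inner[OF mem] by auto
      have fu: "solv_bracket k n ?u v = f (bvec (E m))"
          unfolding v(2)[symmetric] linear_endo_add[OF lin probe_mem[OF j(1)] e] f_probe[OF j(1)] by simp
      have "solv_bracket k n ?u v (E 1) = - v (E 1)"
        unfolding solv_bracket_E[OF mem v(1)] act_add act_E act_probe_1[OF j(1)]
        using m by (simp add: probe_E bvec_apply)
      then have "v (E 1) = 0" using fu gen[of 1] m True by simp
      then have "solv_bracket k n ?u v (E (m + 1)) = 0"
        unfolding solv_bracket_E[OF mem v(1)] act_add act_E act_probe[OF j]
        using m by (simp add: probe_E bvec_apply)
      then show ?thesis using fu True by simp
    next
      case False
      then show ?thesis using gen p by blast
    qed
  qed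

  have e1_block: "f (bvec (E 1)) (E p) = 0" if j: "j \<in> {1..k}" "p \<in> block n j" for j p
    using j(2)
  proof (induction p rule: less_induct)
    case (less p)
    \<comment> \<open>By induction hypothesis \<open>v\<close> vanishes in the block below \<open>p\<close>, while the probe removes
      \<open>v (E p)\<close> from the coordinate at \<open>e\<^sub>p\<close>.\<close>
    let ?u = "probe j p + bvec (E 1) :: generator \<Rightarrow> 'f"
    have mem: "?u \<in> ?L" by (intro solv_space_add e1 probe_mem j(1))
    obtain v where v: "v \<in> ?L" "f ?u = solv_bracket k n ?u v"
      using inner[OF mem] by auto
    have fu: "f ?u = f (bvec (E 1))"
      unfolding linear_endo_add[OF lin probe_mem[OF j(1)] e1] f_probe[OF j(1)] by simp
    have coord: "f (bvec (E 1)) (E q) =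
        - (v (E q) * (of_nat q - of_nat p) + (if q - 1 \<in> block n j then v (E (q - 1)) else 0))"
      if q: "q \<in> block n j" for q
      unfolding fu[symmetric] v(2) solv_bracket_E[OF mem v(1)] act_add act_E act_probe[OF j(1) q]
        prev[OF j(1) q]
      using block_range(1)[OF j(1) q] block_range(1)[OF j(1), of "q - 1" n]
      by (auto simp: probe_E bvec_apply)
    have "v (E q) = 0" if "q \<in> block n j" "q < p" for q
    proof (rule block_recurrence_eq_0[OF _ order_refl that])
      fix q assume q: "q \<in> block n j" "q < p"
      have "f (bvec (E 1)) (E q) = 0" by (rule less.IH[OF q(2,1)])
      then show "v (E q) * (of_nat q - of_nat p) + (if q - 1 \<in> block n j then v (E (q - 1)) else 0) = 0"
        unfolding coord[OF q(1)] neg_equal_0_iff_equal .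
    qed
    then show ?case using coord[OF less.prems] block_range(1)[OF j(1) less.prems] by auto
  qed

  have E_coord: "f (bvec (E m)) (E p) = 0" if m: "m \<in> {1..nil_dim k n}" "p \<noteq> m" for m p
  proof (cases "m = 1")
    case True
    show ?thesis
    proof (cases "p \<in> {2..nil_dim k n}")
      case True
      then show ?thesis using \<open>m = 1\<close> ex_block[of p k n] e1_block by auto
    next
      case False
      have "f (bvec (E 1)) \<in> ?L" using lin e1 by (simp add: linear_endo_def)
      moreover have "E p \<notin> solv_basis k n" using False m \<open>m = 1\<close> by (auto simp: solv_basis_def)
      ultimately show ?thesis using \<open>m = 1\<close> by (simp add: solv_space_def)
    qed
  qed (use off_diag m in blast)

  have fe1: "f (bvec (E 1)) = 0"
  proof
    fix g
    show "f (bvec (E 1)) g = 0 g"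
      using norm E_coord[OF one_le_nil_dim] f_X[OF e1]
      by (cases g; cases "g = E 1") (auto simp: normalised_def)
  qed

  have step: "f (bvec (E (m + 1))) (E (m + 1)) = f (bvec (E m)) (E m)" if c: "chain k n m" for m
  proof -
    define r where "r = m + 1"
    have m: "m \<in> {1..nil_dim k n}" "r \<in> {1..nil_dim k n}" "m \<noteq> 0" "m \<noteq> 1" "r \<noteq> 1"
      using chain_bounds[OF c] by (auto simp: r_def)
    obtain j where j: "j \<in> {1..k}" "r \<in> block n j" "m \<in> block n j"
      using ex_block[of r k n] m chain_iff_block[of _ k m n] c by (force simp: r_def)
    \<comment> \<open>The coordinates at \<open>e\<^sub>m\<close> and \<open>e\<^sub>r\<close> both contain \<open>v (E m)\<close> and the eigenvalue of \<open>v\<close> on the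
      block.  With the opposite signs of \<open>e\<^sub>m\<close> and \<open>e\<^sub>r\<close> these unknowns cancel in the sum of the two
      coordinates, which leaves \<open>v (E 1) - v (X 1)\<close> as the difference of the diagonal coefficients;
      the coordinate at \<open>e\<^sub>1\<close> shows that this is zero.\<close>
    let ?u = "probe j r + bvec (E 1) + bvec (E m) - bvec (E r) :: generator \<Rightarrow> 'f"
    have e: "bvec (E m) \<in> ?L" "bvec (E r) \<in> ?L" using m by (auto intro: bvec_E_mem)
    have mem1: "probe j r + bvec (E 1) \<in> ?L"
      and mem2: "probe j r + bvec (E 1) + bvec (E m) \<in> ?L" and mem: "?u \<in> ?L"
      by (intro solv_space_add solv_space_diff e e1 probe_mem j(1))+
    obtain v where v: "v \<in> ?L" "f ?u = solv_bracket k n ?u v"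
      using inner[OF mem] by auto
    have fu: "f ?u = f (bvec (E m)) - f (bvec (E r))"
      unfolding linear_endo_diff[OF lin mem2 e(2)] linear_endo_add[OF lin mem1 e(1)]
        linear_endo_add[OF lin probe_mem[OF j(1)] e1] f_probe[OF j(1)] fe1 by simp
    have "solv_bracket k n ?u v (E 1) = act k n v 1 - v (E 1)"
      unfolding solv_bracket_E[OF mem v(1)] act_add act_diff act_E act_probe_1[OF j(1)]
      using m by (simp add: probe_E bvec_apply)
    moreover have "f ?u (E 1) = 0" using E_coord[OF m(1), of 1] E_coord[OF m(2), of 1] m fu by simp
    ultimately have v1: "act k n v 1 = v (E 1)" using v(2) by simp
    have low: "v (E q) = 0" if "q \<in> block n j" "q < m" for q
    proof (rule block_recurrence_eq_0[OF _ _ that])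
      show "m \<le> r" by (simp add: r_def)
      fix q assume q: "q \<in> block n j" "q < m"
      have "f ?u (E q) = - (v (E q) * (of_nat q - of_nat r) + (if q - 1 \<in> block n j then v (E (q - 1)) else 0))"
        unfolding v(2) solv_bracket_E[OF mem v(1)] act_add act_diff act_E act_probe[OF j(1) q(1)]
          prev[OF j(1) q(1)]
        using q(2) block_range(1)[OF j(1) q(1)] block_range(1)[OF j(1), of "q - 1" n]
        by (auto simp: probe_E bvec_apply r_def)
      moreover have "f ?u (E q) = 0"
        using E_coord[OF m(1), of q] E_coord[OF m(2), of q] q fu by (simp add: r_def)
      ultimately show "v (E q) * (of_nat q - of_nat r) + (if q - 1 \<in> block n j then v (E (q - 1)) else 0) = 0"
        by (metis neg_equal_0_iff_equal)
    qed
    have "f ?u (E m) = act k n v m + v (E m)"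
      unfolding v(2) solv_bracket_E[OF mem v(1)] act_add act_diff act_E act_probe[OF j(1) j(3)]
        prev[OF j(1) j(3)]
      using m low[of "m - 1"] block_range(1)[OF j(1), of "m - 1" n]
      by (auto simp: probe_E bvec_apply r_def)
    then have bm: "f (bvec (E m)) (E m) = act k n v m + v (E m)"
      using E_coord[OF m(2), of m] fu by (simp add: r_def)
    have "f ?u (E r) = - act k n v r + v (E 1) - v (E m)"
      unfolding v(2) solv_bracket_E[OF mem v(1)] act_add act_diff act_E act_probe[OF j(1) j(2)]
      using m c by (simp add: probe_E bvec_apply r_def)
    then have br: "f (bvec (E r)) (E r) = act k n v r - v (E 1) + v (E m)"
      using E_coord[OF m(1), of r] unfolding fu by (simp add: r_def algebra_simps)
    show ?thesis using bm br v1 act_chain[OF c, of v] unfolding r_def by (simp add: algebra_simps)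
  qed

  show ?thesis
  proof (rule linear_endo_eq_0[OF lin _ _ u])
    fix l assume "l \<in> {1..k + 1}"
    then have "l = 1 \<or> l - 1 \<in> {1..k} \<and> l = (l - 1) + 1" by auto
    then show "f (bvec (X l)) = 0" using fx[of "l - 1"] fx1 by auto
  next
    fix m assume m: "m \<in> {1..nil_dim k n}"
    show "f (bvec (E m)) = 0"
    proof
      fix g
      show "f (bvec (E m)) g = 0 g"
        using E_coord[OF m] diagonal_eq_0[OF norm step m] f_X[OF bvec_E_mem[OF m]]
        by (cases g; cases "g = E m") auto
    qed
  qed
qed

theorem theorem4p3:
  fixes k :: nat and n :: "nat \<Rightarrow> nat"
    and \<Delta> :: "(generator \<Rightarrow> 'f::field_char_0) \<Rightarrow> (generator \<Rightarrow> 'f)"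
  assumes "1 \<le> k"
    and "\<forall>j\<in>{1..k}. 1 \<le> n j"
    and "\<forall>j\<in>{1..<k}. n (Suc j) \<le> n j"
    and "local_derivation fscale (solv_space k n) (solv_bracket k n) \<Delta>"
  shows "derivation fscale (solv_space k n) (solv_bracket k n) \<Delta>"
proof -
  let ?L = "solv_space k n :: (generator \<Rightarrow> 'f) set"
  note pos = assms(2)
  have inner: "\<exists>v\<in>?L. D u = solv_bracket k n u v"
    if "local_derivation fscale ?L (solv_bracket k n) D" "u \<in> ?L" for D u
    using that derivation_inner[OF pos] unfolding local_derivation_def by metis
  have lin: "linear_endo fscale ?L \<Delta>" using assms(4) by (simp add: local_derivation_def)
  have "bvec (X 1) \<in> ?L" by (intro bvec_X_mem) simp
  then have "\<Delta> (bvec (X 1)) (X l) = 0" for l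
    using inner[OF assms(4)] by fastforce
  then obtain v where v: "v \<in> ?L" "normalised k n (\<lambda>u. \<Delta> u - solv_bracket k n u v)"
    using ex_normalising_bracket[OF pos lin] by auto
  note ad = solv.derivation_right_bracket[OF v(1)]
  note loc = solv.local_derivation_diff[OF assms(4) ad]
  have "\<Delta> u - solv_bracket k n u v = 0" if "u \<in> ?L" for u
    by (rule normalised_pointwise_inner_eq_0[OF _ inner[OF loc] v(2) that])
      (use loc in \<open>simp_all add: local_derivation_def\<close>)
  then have "\<Delta> u = solv_bracket k n u v" if "u \<in> ?L" for u
    using that by simp
  then show ?thesis by (rule solv.derivation_cong[OF ad])
qed

end
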